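(* Let $X$ be a compact Hausdorff space, let $A$ be a complex commutative unital Banach algebra, and let $\mathcal{A}=C(X,A)$. For an ideal $\mathcal{M}$ in $\mathcal{A}$ the following are equivalent. (i) The ideal $\mathcal{M}$ is maximal. (ii) The ideals $\mathcal{M}\cap A$ and $\mathcal{M}\cap C(X)$ are maximal, respectively in $A$ and $C(X)$. (iii) There is a unique point $x_0\in X$ such that $\mathcal{M}(x_0)\neq A$ and $\mathcal{M}(x_0)$ is maximal in $A$. (iv) There exist a point $x_0\in X$ and a maximal ideal $M$ in $A$ such that $\mathcal{M}=\{f\in\mathcal{A}: f(x_0)\in M\}$.
   Context: $X$ is a compact Hausdorff space and $C(X)$ is the algebra of all continuous complex-valued functions on $X$. $(A,\|\cdot\|)$ is a complex commutative Banach algebra with identity $\mathbf{1}$, $\|\mathbf{1}\|=1$. $\mathcal{A}=C(X,A)$ is the algebra of all continuous functions $X\to A$ (pointwise operations), with the uniform norm $\|f\|_u=\sup\{\|f(x)\|:x\in X\}$; it is a commutative Banach algebra. An element $a\in A$ is identified with the constant function on $X$ with value $a$, so $A$ is regarded as a closed subalgebra of $\mathcal{A}$; a function $f\in C(X)$ is identified with the function $x\mapsto f(x)\mathbf{1}$, so $C(X)$ is regarded as a closed subalgebra of $\mathcal{A}$. The intersections $\mathcal{M}\cap A$ and $\mathcal{M}\cap C(X)$ are taken with respect to these identifications. For an ideal $\mathcal{I}$ in $\mathcal{A}$ and $x\in X$, $\mathcal{I}(x)=\{f(x): f\in\mathcal{I}\}$, which is an ideal in $A$.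
   Formalization: In (iii) the ideal M is additionally required to be closed in the uniform norm: without this (iii) does not imply (i), e.g. for A = C, X = [0,1] and M the functions vanishing near a point; "unique" is read as the only point with M(x) ≠ A. *)

theory Defs
  imports "HOL-Analysis.Analysis" "HOL-Algebra.Algebraic_Closure_Type"
begin

text \<open>The distribution has only real normed algebras, so the complex scalar multiplication is
  added as an operation extending the real one.  The unit has norm \<open>1\<close> by the axiom of
  \<^class>\<open>real_normed_algebra_1\<close>.\<close>

class complex_comm_banach_algebra_1 = real_normed_algebra_1 + comm_ring_1 + banach +
  fixes scaleC :: "complex \<Rightarrow> 'a \<Rightarrow> 'a"
  assumes scaleC_add_right: "scaleC c (x + y) = scaleC c x + scaleC c y"
    and scaleC_add_left: "scaleC (c + d) x = scaleC c x + scaleC d x"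
    and scaleC_scaleC: "scaleC c (scaleC d x) = scaleC (c * d) x"
    and scaleC_of_real: "scaleC (complex_of_real r) x = r *\<^sub>R x"
    and scaleC_mult_left: "scaleC c x * y = scaleC c (x * y)"
    and norm_scaleC: "norm (scaleC c x) = cmod c * norm x"

text \<open>Since \<open>C(X, A)\<close> and \<open>A\<close> are unital, their ring ideals are automatically complex
  subspaces, so the algebra ideals are exactly the ideals of the underlying rings.\<close>

definition cont_ring :: "('x::topological_space \<Rightarrow> 'a::real_normed_algebra_1) ring" where
  "cont_ring = \<lparr>carrier = {f. continuous_on UNIV f},
     monoid.mult = (\<lambda>f g x. f x * g x), one = (\<lambda>x. 1),
     ring.zero = (\<lambda>x. 0), add = (\<lambda>f g x. f x + g x)\<rparr>"

definition inter_consts :: "('x \<Rightarrow> 'a) set \<Rightarrow> 'a set" where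
  "inter_consts M = {a. (\<lambda>x. a) \<in> M}"

definition inter_scalars ::
    "('x::topological_space \<Rightarrow> 'a::complex_comm_banach_algebra_1) set \<Rightarrow> ('x \<Rightarrow> complex) set" where
  "inter_scalars M = {g. continuous_on UNIV g \<and> (\<lambda>x. scaleC (g x) 1) \<in> M}"

definition values_at :: "('x \<Rightarrow> 'a) set \<Rightarrow> 'x \<Rightarrow> 'a set" where
  "values_at M x = {f x | f. f \<in> M}"

text \<open>On a compact space \<open>'x \<Rightarrow>\<^sub>C 'a\<close> consists of all continuous functions, and its metric
  is the one of the uniform norm.

  Closedness is a separate condition because the fibres \<open>values_at M x\<close> do not determine an
  arbitrary ideal: the functions vanishing near a non-isolated point \<open>x0\<close> form a non-maximal ideal
  of \<open>C(X)\<close> with the same fibres as the maximal ideal at \<open>x0\<close>.\<close>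

definition uniformly_closed :: "('x::topological_space \<Rightarrow> 'a::metric_space) set \<Rightarrow> bool" where
  "uniformly_closed M \<longleftrightarrow> closed {F :: 'x \<Rightarrow>\<^sub>C 'a. apply_bcontfun F \<in> M}"

end

theory Submission
  imports Defs
begin

text \<open>Write \<open>Z x0\<close> for the ideal of functions vanishing at \<open>x0\<close>.  An ideal of \<open>C(X, A)\<close> that
  contains \<open>Z x0\<close> is determined by the constants in it, so such ideals correspond to the
  ideals of \<open>A\<close>, maximal ones to maximal ones.  Hence it is enough to derive \<open>Z x0 \<subseteq> M\<close> for some
  \<open>x0\<close> from each of the conditions.

  Under (i), the scalar functions in \<open>M\<close> have a common zero \<open>x0\<close> by compactness; Urysohn functions
  then put every function vanishing near \<open>x0\<close> into \<open>M\<close>, and truncation extends this to \<open>Z x0\<close>.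
  Under (ii), one factors \<open>f = sqrt \<bar>f\<bar> \<cdot> (f / sqrt \<bar>f\<bar>)\<close> for \<open>f \<in> Z x0\<close>.
  Under (iii), if \<open>h\<close> vanishes near \<open>x0\<close>, then no maximal ideal contains the ideal of all \<open>k\<close> with
  \<open>k h \<in> M\<close>, so \<open>h \<in> M\<close>; closedness of \<open>M\<close> then gives \<open>Z x0 \<subseteq> M\<close>.\<close>

section \<open>Ideals of commutative rings\<close>

text \<open>Closure under negatives comes from multiplying by \<open>\<ominus> \<one>\<close>, and
  commutativity makes left absorption two-sided.\<close>

lemma (in cring) ideal_iff:
  "ideal I R \<longleftrightarrow> I \<subseteq> carrier R \<and> \<zero> \<in> I \<and> (\<forall>a\<in>I. \<forall>b\<in>I. a \<oplus> b \<in> I) \<and>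
     (\<forall>a\<in>I. \<forall>x\<in>carrier R. x \<otimes> a \<in> I)" (is "_ \<longleftrightarrow> ?rhs")
proof
  assume "ideal I R"
  then interpret ideal I R .
  show ?rhs
    by (auto simp: I_l_closed)
next
  assume r: ?rhs
  show "ideal I R"
  proof (rule idealI)
    show "ring R"
      by (rule ring_axioms)
    have "\<ominus> a \<in> I" if "a \<in> I" for a
    proof -
      have "\<ominus> a = (\<ominus> \<one>) \<otimes> a"
        using r that by (subst l_minus) auto
      with r that show ?thesis
        by auto
    qed
    with r show "subgroup I (add_monoid R)"
      by (auto intro!: subgroup.intro simp: a_inv_def)
  qed (use r in \<open>auto simp: m_comm subset_iff\<close>)
qed

text \<open>An ideal containing the unit is the whole ring, so properness can be tested on
  \<open>\<one>\<close> alone.\<close>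

lemma (in cring) maximalideal_iff:
  "maximalideal I R \<longleftrightarrow> ideal I R \<and> \<one> \<notin> I \<and> (\<forall>J. ideal J R \<and> I \<subseteq> J \<and> \<one> \<notin> J \<longrightarrow> J = I)"
proof
  assume "maximalideal I R"
  then interpret maximalideal I R .
  show "ideal I R \<and> \<one> \<notin> I \<and> (\<forall>J. ideal J R \<and> I \<subseteq> J \<and> \<one> \<notin> J \<longrightarrow> J = I)"
    using I_maximal I_notcarr one_imp_carrier is_ideal by (metis ideal.Icarr one_closed subsetI)
next
  assume r: "ideal I R \<and> \<one> \<notin> I \<and> (\<forall>J. ideal J R \<and> I \<subseteq> J \<and> \<one> \<notin> J \<longrightarrow> J = I)"
  show "maximalideal I R"
  proof (rule maximalidealI)
    show "carrier R \<noteq> I"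
      using r by auto
    show "J = I \<or> J = carrier R" if "ideal J R" "I \<subseteq> J" "J \<subseteq> carrier R" for J
      using r that ideal.one_imp_carrier by metis
  qed (use r in auto)
qed

text \<open>Krull's theorem: properness in the form \<open>\<one> \<notin> J\<close> passes to
  unions of chains, so Zorn's lemma applies.\<close>

lemma (in cring) exists_maximalideal:
  assumes "ideal I R" "\<one> \<notin> I"
  obtains J where "maximalideal J R" "I \<subseteq> J"
proof -
  let ?S = "{J. ideal J R \<and> I \<subseteq> J \<and> \<one> \<notin> J}"
  have "\<exists>J\<in>?S. \<forall>K\<in>?S. J \<subseteq> K \<longrightarrow> K = J"
  proof (rule subset_Zorn_nonempty)
    show "?S \<noteq> {}"
      using assms by auto
    fix C assume C: "C \<noteq> {}" "subset.chain ?S C"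
    then have "subset.chain {J. ideal J R} C"
      unfolding subset.chain_def by auto
    from chain_Union_is_ideal[OF this] C show "\<Union>C \<in> ?S"
      unfolding subset.chain_def by auto
  qed
  then obtain J where J: "J \<in> ?S" "\<forall>K\<in>?S. J \<subseteq> K \<longrightarrow> K = J" ..
  then have "maximalideal J R"
    unfolding maximalideal_iff by auto
  with J that show thesis
    by auto
qed

section \<open>The criteria for the rings \<open>A\<close> and \<open>C(X, A)\<close>\<close>

lemma ideal_type_algebra_iff:
  "ideal I (ring_of_type_algebra :: 'a::comm_ring_1 ring) \<longleftrightarrow>
     0 \<in> I \<and> (\<forall>a\<in>I. \<forall>b\<in>I. a + b \<in> I) \<and> (\<forall>a\<in>I. \<forall>x. x * a \<in> I)"
  by (subst cring.ideal_iff[OF cring_from_type_algebra]) (simp add: ring_of_type_algebra_def)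

lemma maximalideal_type_algebra_iff:
  "maximalideal I (ring_of_type_algebra :: 'a::comm_ring_1 ring) \<longleftrightarrow>
     ideal I ring_of_type_algebra \<and> 1 \<notin> I \<and>
     (\<forall>J. ideal J ring_of_type_algebra \<and> I \<subseteq> J \<and> 1 \<notin> J \<longrightarrow> J = I)"
  by (subst cring.maximalideal_iff[OF cring_from_type_algebra]) (simp add: ring_of_type_algebra_def)

lemma cring_cont_ring:
  "cring (cont_ring :: ('x::topological_space \<Rightarrow> 'a::{real_normed_algebra_1,comm_ring_1}) ring)"
proof (intro cringI abelian_groupI comm_monoidI)
  fix f :: "'x \<Rightarrow> 'a" assume "f \<in> carrier cont_ring"
  then show "\<exists>g\<in>carrier cont_ring. g \<oplus>\<^bsub>cont_ring\<^esub> f = \<zero>\<^bsub>cont_ring\<^esub>"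
    by (intro bexI[of _ "\<lambda>x. - f x"]) (auto simp: cont_ring_def intro!: continuous_on_minus)
qed (simp_all add: cont_ring_def continuous_on_add continuous_on_mult add_ac mult_ac distrib_left)

lemma ideal_cont_ring_iff:
  fixes I :: "('x::topological_space \<Rightarrow> 'a::{real_normed_algebra_1,comm_ring_1}) set"
  shows "ideal I cont_ring \<longleftrightarrow>
     (\<forall>f\<in>I. continuous_on UNIV f) \<and> (\<lambda>x. 0) \<in> I \<and> (\<forall>f\<in>I. \<forall>g\<in>I. (\<lambda>x. f x + g x) \<in> I) \<and>
     (\<forall>f\<in>I. \<forall>g. continuous_on UNIV g \<longrightarrow> (\<lambda>x. g x * f x) \<in> I)"
  by (subst cring.ideal_iff[OF cring_cont_ring]) (simp add: cont_ring_def subset_eq)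

lemma maximalideal_cont_ring_iff:
  fixes I :: "('x::topological_space \<Rightarrow> 'a::{real_normed_algebra_1,comm_ring_1}) set"
  shows "maximalideal I cont_ring \<longleftrightarrow> ideal I cont_ring \<and> (\<lambda>x. 1) \<notin> I \<and>
     (\<forall>J. ideal J cont_ring \<and> I \<subseteq> J \<and> (\<lambda>x. 1) \<notin> J \<longrightarrow> J = I)"
  by (subst cring.maximalideal_iff[OF cring_cont_ring]) (simp add: cont_ring_def)

context
  fixes I :: "('x::topological_space \<Rightarrow> 'a::{real_normed_algebra_1,comm_ring_1}) set"
  assumes I: "ideal I cont_ring"
begin

lemma cont_ideal_continuous: "f \<in> I \<Longrightarrow> continuous_on UNIV f"
  and cont_ideal_zero: "(\<lambda>x. 0) \<in> I"
  and cont_ideal_add: "f \<in> I \<Longrightarrow> g \<in> I \<Longrightarrow> (\<lambda>x. f x + g x) \<in> I"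
  and cont_ideal_mult: "f \<in> I \<Longrightarrow> continuous_on UNIV g \<Longrightarrow> (\<lambda>x. g x * f x) \<in> I"
  using I by (auto simp: ideal_cont_ring_iff)

lemma cont_ideal_diff:
  assumes "f \<in> I" "g \<in> I"
  shows "(\<lambda>x. f x - g x) \<in> I"
  using cont_ideal_add[OF assms(1) cont_ideal_mult[OF assms(2), of "\<lambda>x. - 1"]] by simp

end

text \<open>The ideal \<open>?J\<close> generated by \<open>M\<close> and \<open>f\<close> is
  strictly larger than \<open>M\<close>, so it contains 1; thus \<open>f\<close> is invertible
  modulo \<open>M\<close>.\<close>

lemma maximalideal_cont_ring_complement:
  fixes M :: "('x::topological_space \<Rightarrow> 'a::{real_normed_algebra_1,comm_ring_1}) set"
  assumes M: "maximalideal M cont_ring" and f: "continuous_on UNIV f" "f \<notin> M"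
  obtains k where "continuous_on UNIV k" "(\<lambda>x. 1 - k x * f x) \<in> M"
proof -
  have id: "ideal M cont_ring"
    using M by (simp add: maximalideal_cont_ring_iff)
  let ?J = "{g. \<exists>m\<in>M. \<exists>k. continuous_on UNIV k \<and> g = (\<lambda>x. m x + k x * f x)}"
  have "ideal ?J cont_ring"
    unfolding ideal_cont_ring_iff
  proof (intro conjI ballI allI impI)
    show "continuous_on UNIV g" if "g \<in> ?J" for g
      using that f cont_ideal_continuous[OF id] by (auto intro!: continuous_intros)
    show "(\<lambda>x. 0) \<in> ?J"
      using cont_ideal_zero[OF id] by (auto intro!: bexI[of _ "\<lambda>x. 0"] exI[of _ "\<lambda>x. 0"])
    show "(\<lambda>x. g x + h x) \<in> ?J" if gh: "g \<in> ?J" "h \<in> ?J" for g h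
    proof -
      obtain m k m' k' where "m \<in> M" "continuous_on UNIV k" "g = (\<lambda>x. m x + k x * f x)"
        "m' \<in> M" "continuous_on UNIV k'" "h = (\<lambda>x. m' x + k' x * f x)"
        using gh by blast
      then show ?thesis
        by (intro CollectI bexI[of _ "\<lambda>x. m x + m' x"] exI[of _ "\<lambda>x. k x + k' x"])
          (auto simp: algebra_simps intro!: continuous_intros cont_ideal_add[OF id])
    qed
    show "(\<lambda>x. h x * g x) \<in> ?J" if gh: "g \<in> ?J" "continuous_on UNIV h" for g h
    proof -
      obtain m k where "m \<in> M" "continuous_on UNIV k" "g = (\<lambda>x. m x + k x * f x)"
        using gh by blast
      with gh(2) show ?thesis
        by (intro CollectI bexI[of _ "\<lambda>x. h x * m x"] exI[of _ "\<lambda>x. h x * k x"])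
          (auto simp: algebra_simps intro!: continuous_intros cont_ideal_mult[OF id])
    qed
  qed
  moreover have "M \<subseteq> ?J"
    by (auto intro!: bexI exI[of _ "\<lambda>x. 0"])
  moreover have "f \<in> ?J"
    using cont_ideal_zero[OF id] by (auto intro!: bexI[of _ "\<lambda>x. 0"] exI[of _ "\<lambda>x. 1"])
  moreover have "J = M" if "ideal J cont_ring" "M \<subseteq> J" "(\<lambda>x. 1) \<notin> J" for J
    using M that by (simp add: maximalideal_cont_ring_iff)
  ultimately have "(\<lambda>x. 1) \<in> ?J"
    using f(2) by blast
  then obtain m k where m: "m \<in> M" "continuous_on UNIV k" "(\<lambda>x. 1) = (\<lambda>x. m x + k x * f x)"
    by blast
  then have "m = (\<lambda>x. 1 - k x * f x)"
    by (metis (no_types, lifting) add_diff_cancel_right')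
  with m that show thesis
    by blast
qed

section \<open>Ideals containing all functions that vanish at a point\<close>

text \<open>The kernel of evaluation at \<open>x0\<close>, called \<open>Z x0\<close> above. It
  serves both for values in \<open>A\<close> and for complex values.\<close>

definition vanishing_at :: "'x::topological_space \<Rightarrow> ('x \<Rightarrow> 'a::real_normed_algebra_1) set" where
  "vanishing_at x0 = {f. continuous_on UNIV f \<and> f x0 = 0}"

lemma ideal_evaluation:
  fixes N :: "'a::{real_normed_algebra_1,comm_ring_1} set" and x0 :: "'x::topological_space"
  assumes "ideal N ring_of_type_algebra"
  shows "ideal {f. continuous_on UNIV f \<and> f x0 \<in> N} cont_ring"
  using assms unfolding ideal_cont_ring_iff ideal_type_algebra_iff
  by (simp add: continuous_on_add continuous_on_mult)

lemma inter_consts_evaluation: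
  "inter_consts {f. continuous_on UNIV f \<and> f x0 \<in> N} = N"
  by (simp add: inter_consts_def)

lemma ideal_inter_consts:
  fixes J :: "('x::topological_space \<Rightarrow> 'a::{real_normed_algebra_1,comm_ring_1}) set"
  assumes "ideal J cont_ring"
  shows "ideal (inter_consts J) ring_of_type_algebra"
  unfolding ideal_type_algebra_iff inter_consts_def
  using cont_ideal_zero[OF assms] cont_ideal_add[OF assms] cont_ideal_mult[OF assms] by simp

text \<open>The difference of \<open>f\<close> and the constant \<open>f x0\<close> vanishes at
  \<open>x0\<close>, so it lies in \<open>J\<close>.\<close>

lemma cont_ideal_mem_iff:
  fixes J :: "('x::topological_space \<Rightarrow> 'a::{real_normed_algebra_1,comm_ring_1}) set"
  assumes J: "ideal J cont_ring" and van: "vanishing_at x0 \<subseteq> J"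
  shows "f \<in> J \<longleftrightarrow> continuous_on UNIV f \<and> f x0 \<in> inter_consts J"
proof (cases "continuous_on UNIV f")
  case True
  then have v: "(\<lambda>x. f x - f x0) \<in> J"
    using van by (auto simp: vanishing_at_def subset_iff intro!: continuous_intros)
  have "f \<in> J \<longleftrightarrow> (\<lambda>x. f x0) \<in> J"
  proof
    assume "f \<in> J"
    from cont_ideal_diff[OF J this v] show "(\<lambda>x. f x0) \<in> J"
      by simp
  next
    assume "(\<lambda>x. f x0) \<in> J"
    from cont_ideal_add[OF J this v] show "f \<in> J"
      by simp
  qed
  with True show ?thesis
    by (simp add: inter_consts_def)
qed (use cont_ideal_continuous[OF J] in auto)

context
  fixes J :: "('x::topological_space \<Rightarrow> 'a::{real_normed_algebra_1,comm_ring_1}) set" and x0 :: 'x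
  assumes J: "ideal J cont_ring" and van: "vanishing_at x0 \<subseteq> J"
begin

lemma eq_evaluation: "J = {f. continuous_on UNIV f \<and> f x0 \<in> inter_consts J}"
  by (intro Set.set_eqI) (simp add: cont_ideal_mem_iff[OF J van])

lemma values_at_eq_inter_consts: "values_at J x0 = inter_consts J"
proof (intro Set.set_eqI iffI)
  fix a assume "a \<in> values_at J x0"
  then show "a \<in> inter_consts J"
    by (auto simp: values_at_def cont_ideal_mem_iff[OF J van])
next
  fix a assume "a \<in> inter_consts J"
  then have "(\<lambda>x. a) \<in> J"
    by (simp add: inter_consts_def)
  then show "a \<in> values_at J x0"
    by (force simp: values_at_def)
qed

text \<open>A proper ideal \<open>N\<close> above the constants of \<open>J\<close> pulls back along
  evaluation to a proper ideal \<open>?E\<close> above \<open>J\<close>. Conversely, an ideal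
  \<open>K\<close> above \<open>J\<close> still contains \<open>vanishing_at x0\<close>, so its
  constants determine it.\<close>

lemma maximalideal_iff_inter_consts:
  "maximalideal J cont_ring \<longleftrightarrow> maximalideal (inter_consts J) ring_of_type_algebra"
proof
  assume m: "maximalideal J cont_ring"
  show "maximalideal (inter_consts J) ring_of_type_algebra"
    unfolding maximalideal_type_algebra_iff
  proof (intro conjI allI impI)
    show "ideal (inter_consts J) ring_of_type_algebra"
      by (rule ideal_inter_consts[OF J])
    show "1 \<notin> inter_consts J"
      using m by (simp add: maximalideal_cont_ring_iff inter_consts_def)
    fix N assume N: "ideal N ring_of_type_algebra \<and> inter_consts J \<subseteq> N \<and> 1 \<notin> N"
    let ?E = "{f :: 'x \<Rightarrow> 'a. continuous_on UNIV f \<and> f x0 \<in> N}"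
    have "?E = J"
      using m N ideal_evaluation[of N x0] cont_ideal_mem_iff[OF J van]
      unfolding maximalideal_cont_ring_iff by blast
    then have "inter_consts ?E = inter_consts J"
      by simp
    then show "N = inter_consts J"
      by (simp add: inter_consts_evaluation)
  qed
next
  assume m: "maximalideal (inter_consts J) ring_of_type_algebra"
  show "maximalideal J cont_ring"
    unfolding maximalideal_cont_ring_iff
  proof (intro conjI allI impI)
    show "(\<lambda>x. 1) \<notin> J"
      using m by (simp add: maximalideal_type_algebra_iff inter_consts_def)
    fix K :: "('x \<Rightarrow> 'a) set" assume K: "ideal K cont_ring \<and> J \<subseteq> K \<and> (\<lambda>x. 1) \<notin> K"
    have "inter_consts K = inter_consts J"
      using m K ideal_inter_consts[of K] unfolding maximalideal_type_algebra_iff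
      by (auto simp: inter_consts_def)
    moreover have "f \<in> K \<longleftrightarrow> continuous_on UNIV f \<and> f x0 \<in> inter_consts K" for f
      using cont_ideal_mem_iff[of K x0 f] K van by auto
    ultimately show "K = J"
      using cont_ideal_mem_iff[OF J van] by blast
  qed (rule J)
qed

end

section \<open>Continuous functions on compact Hausdorff spaces\<close>

text \<open>Urysohn's lemma for a point and a closed set; normality holds because the space is
  compact and Hausdorff.\<close>

lemma compact_separation:
  fixes x0 :: "'x::t2_space"
  assumes comp: "compact (UNIV :: 'x set)" and T: "closed T" "x0 \<notin> T"
  obtains \<phi> :: "'x \<Rightarrow> real" where "continuous_on UNIV \<phi>" "\<phi> x0 = 1" "\<And>x. x \<in> T \<Longrightarrow> \<phi> x = 0"
proof -
  have "compact_space (euclidean :: 'x topology)"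
    using comp by (simp add: compact_space_def)
  moreover have "Hausdorff_space (euclidean :: 'x topology)"
    by (simp add: Hausdorff_space_def disjnt_def) (metis hausdorff)
  ultimately have "normal_space (euclidean :: 'x topology)"
    by (simp add: compact_Hausdorff_or_regular_imp_normal_space)
  then obtain \<phi> where "continuous_map euclidean euclideanreal \<phi>" "\<phi> ` {x0} \<subseteq> {1}" "\<phi> ` T \<subseteq> {0}"
    by (rule Urysohn_lemma_alt[where S = "{x0}" and T = T and a = 1 and b = 0]) (use T in auto)
  then show thesis
    by (intro that[of \<phi>]) auto
qed

text \<open>The inverse is the Neumann series of \<open>u x\<close>. The uniform bound 1/2 makes it
  converge uniformly, so the sum is continuous.\<close>

lemma geometric_inverse:
  fixes u :: "'x::topological_space \<Rightarrow> 'a::{real_normed_algebra_1,banach}"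
  assumes u: "continuous_on UNIV u" "\<And>x. norm (u x) \<le> 1/2"
  obtains v where "continuous_on UNIV v" "\<And>x. v x * (1 - u x) = 1"
proof -
  define v where "v x = (\<Sum>n. u x ^ n)" for x
  have "norm (u x ^ n) \<le> (1/2) ^ n" for n x
    using norm_power_ineq[of "u x" n] power_mono[OF u(2)[of x], of n] by simp
  then have "uniform_limit UNIV (\<lambda>n x. \<Sum>i<n. u x ^ i) v sequentially"
    unfolding v_def by (intro Weierstrass_m_test[of _ _ "\<lambda>n. (1/2) ^ n"]) (auto simp: summable_geometric)
  then have "continuous_on UNIV v"
    by (rule uniform_limit_theorem[rotated]) (simp_all add: continuous_on_sum continuous_on_power u)
  moreover have "v x * (1 - u x) = 1" for x
  proof -
    have s: "summable (\<lambda>n. u x ^ n)"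
      using u(2)[of x] by (intro complete_algebra_summable_geometric) auto
    have "v x * u x = (\<Sum>n. u x ^ Suc n)"
      unfolding v_def by (subst suminf_mult2[OF s]) (simp add: power_Suc2 del: power_Suc)
    also have "\<dots> = v x - 1"
      unfolding v_def using suminf_split_head[OF s] by simp
    finally show ?thesis
      by (simp add: right_diff_distrib)
  qed
  ultimately show thesis
    by (rule that)
qed

text \<open>Elements within distance 1/2 of 1 are units, so \<open>N\<close> avoids that ball and
  its closure is still a proper ideal. Maximality then gives \<open>closure N = N\<close>.\<close>

lemma closed_maximalideal:
  fixes N :: "'a::{real_normed_algebra_1,comm_ring_1,banach} set"
  assumes N: "maximalideal N ring_of_type_algebra"
  shows "closed N"
proof -
  have id: "ideal N ring_of_type_algebra" and one: "1 \<notin> N"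
    using N by (auto simp: maximalideal_type_algebra_iff)
  have far: "1/2 < norm (1 - n)" if n: "n \<in> N" for n
  proof (rule ccontr)
    assume "\<not> 1/2 < norm (1 - n)"
    \<comment> \<open>A single element is treated as a constant function; the domain
      \<open>real\<close> is an arbitrary choice.\<close>
    then obtain v :: "real \<Rightarrow> 'a" where "\<And>x. v x * (1 - (1 - n)) = 1"
      using geometric_inverse[of "\<lambda>x::real. 1 - n"] by auto
    then have "v 0 * n = 1"
      by simp
    moreover have "v 0 * n \<in> N"
      using id n by (simp add: ideal_type_algebra_iff)
    ultimately show False
      using one by simp
  qed
  have "ideal (closure N) ring_of_type_algebra"
    unfolding ideal_type_algebra_iff
  proof (intro conjI ballI allI)
    show "0 \<in> closure N"
      using id closure_subset by (auto simp: ideal_type_algebra_iff)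
    show "a + b \<in> closure N" if ab: "a \<in> closure N" "b \<in> closure N" for a b
    proof -
      obtain s t where st: "\<forall>n. s n \<in> N" "s \<longlonglongrightarrow> a" "\<forall>n. t n \<in> N" "t \<longlonglongrightarrow> b"
        using ab by (auto simp: closure_sequential)
      have "\<forall>n. s n + t n \<in> N"
        using id st by (simp add: ideal_type_algebra_iff)
      moreover have "(\<lambda>n. s n + t n) \<longlonglongrightarrow> a + b"
        by (intro tendsto_add st)
      ultimately show ?thesis
        unfolding closure_sequential by (intro exI[of _ "\<lambda>n. s n + t n"] conjI)
    qed
    show "x * a \<in> closure N" if a: "a \<in> closure N" for a x
    proof -
      obtain s where s: "\<forall>n. s n \<in> N" "s \<longlonglongrightarrow> a"
        using a by (auto simp: closure_sequential)
      have "\<forall>n. x * s n \<in> N"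
        using id s by (simp add: ideal_type_algebra_iff)
      moreover have "(\<lambda>n. x * s n) \<longlonglongrightarrow> x * a"
        by (intro tendsto_mult_left s)
      ultimately show ?thesis
        unfolding closure_sequential by (intro exI[of _ "\<lambda>n. x * s n"] conjI)
    qed
  qed
  moreover have "1 \<notin> closure N"
  proof
    assume "1 \<in> closure N"
    then obtain n where "n \<in> N" "dist 1 n < 1/2"
      using closure_approachableD[of 1 N "1/2"] by auto
    with far[of n] show False
      by (simp add: dist_norm)
  qed
  ultimately have "closure N = N"
    using N by (simp add: maximalideal_type_algebra_iff closure_subset)
  then show ?thesis
    by (simp flip: closure_eq)
qed

text \<open>Compose \<open>w\<close> with the radial retraction onto the ball of radius
  \<open>e\<close>. If \<open>w\<close> vanishes at a point, the difference of \<open>w\<close> and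
  \<open>u\<close> vanishes near that point.\<close>

lemma continuous_truncation:
  fixes w :: "'x::topological_space \<Rightarrow> 'a::real_normed_vector"
  assumes w: "continuous_on UNIV w" and "e > 0"
  obtains u where "continuous_on UNIV u" "\<And>x. norm (u x) \<le> e"
    "\<And>x. norm (w x) < e \<Longrightarrow> u x = w x"
proof -
  define u where "u x = (e / max e (norm (w x))) *\<^sub>R w x" for x
  show thesis
  proof
    have "max e (norm (w x)) \<noteq> 0" for x
      using \<open>e > 0\<close> by (auto simp: max_def)
    then show "continuous_on UNIV u"
      unfolding u_def using w by (intro continuous_intros) auto
    show "norm (u x) \<le> e" for x
    proof -
      have "norm (u x) = e * norm (w x) / max e (norm (w x))"
        using \<open>e > 0\<close> by (simp add: u_def)
      also have "\<dots> \<le> e"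
        using \<open>e > 0\<close> by (simp add: pos_divide_le_eq max_def)
      finally show ?thesis .
    qed
    show "u x = w x" if "norm (w x) < e" for x
      using that \<open>e > 0\<close> by (simp add: u_def)
  qed
qed

lemma open_norm_less:
  assumes "continuous_on UNIV f"
  shows "open {x. norm (f x) < e}"
  using assms by (intro open_Collect_less continuous_intros)

text \<open>Without a common zero, compactness yields finitely many members of \<open>I\<close> with
  no common zero, and the sum of their squared moduli is an invertible member of
  \<open>I\<close>.\<close>

lemma scalar_ideal_common_zero:
  fixes I :: "('x::topological_space \<Rightarrow> complex) set"
  assumes comp: "compact (UNIV :: 'x set)" and I: "ideal I cont_ring" and one: "(\<lambda>x. 1) \<notin> I"
  obtains x0 where "I \<subseteq> vanishing_at x0"
proof (rule ccontr)
  assume nt: "\<not> thesis"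
  have "\<exists>g. g \<in> I \<and> g x \<noteq> 0" for x
  proof (rule ccontr)
    assume "\<nexists>g. g \<in> I \<and> g x \<noteq> 0"
    then have "I \<subseteq> vanishing_at x"
      using cont_ideal_continuous[OF I] by (auto simp: vanishing_at_def)
    with that nt show False
      by blast
  qed
  then obtain G where G: "\<And>x. G x \<in> I" "\<And>x. G x x \<noteq> 0"
    by metis
  note cG = cont_ideal_continuous[OF I G(1)]
  have op: "open {y. G x y \<noteq> 0}" for x
    by (rule open_Collect_neq[OF cG continuous_on_const])
  have cover: "(UNIV :: 'x set) \<subseteq> (\<Union>x\<in>UNIV. {y. G x y \<noteq> 0})"
    using G(2) by auto
  obtain D where D: "finite D" "(UNIV :: 'x set) \<subseteq> (\<Union>x\<in>D. {y. G x y \<noteq> 0})"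
    using compactE_image[OF comp op cover] by auto
  \<comment> \<open>Each squared modulus is written as a multiple of \<open>G x\<close>, which shows
    that it lies in \<open>I\<close>.\<close>
  define s where "s y = (\<Sum>x\<in>D. cnj (G x y) * G x y)" for y
  have "(\<lambda>y. \<Sum>x\<in>D. cnj (G x y) * G x y) \<in> I"
    using D(1)
  proof induction
    case (insert x F)
    have "(\<lambda>y. cnj (G x y) * G x y) \<in> I"
      by (rule cont_ideal_mult[OF I G(1) continuous_on_cnj[OF cG]])
    from cont_ideal_add[OF I this insert.IH] insert.hyps show ?case
      by simp
  qed (simp add: cont_ideal_zero[OF I])
  then have s: "s \<in> I"
    by (simp add: s_def[abs_def])
  have nz: "s y \<noteq> 0" for y
  proof -
    have "y \<in> (\<Union>x\<in>D. {y. G x y \<noteq> 0})"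
      using D(2) by (rule subsetD) simp
    then obtain x where x: "x \<in> D" "G x y \<noteq> 0"
      by auto
    have "s y = of_real (\<Sum>x\<in>D. (cmod (G x y))\<^sup>2)"
      unfolding s_def of_real_sum complex_norm_square by (simp add: mult.commute)
    moreover have "(\<Sum>x\<in>D. (cmod (G x y))\<^sup>2) > 0"
      using x by (intro sum_pos2[OF D(1), of x]) auto
    ultimately show ?thesis
      by (metis less_irrefl of_real_eq_0_iff)
  qed
  have "(\<lambda>y. inverse (s y) * s y) \<in> I"
    using nz by (intro cont_ideal_mult[OF I s] continuous_on_inverse cont_ideal_continuous[OF I s]) auto
  with nz one show False
    by simp
qed

text \<open>This is the evaluation ideal over \<open>{0}\<close>, and the zero ideal of the field of
  complex numbers is maximal.\<close>

lemma maximalideal_vanishing_at: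
  "maximalideal (vanishing_at x0 :: ('x::topological_space \<Rightarrow> complex) set) cont_ring"
proof -
  have eq: "vanishing_at x0 = {f :: 'x \<Rightarrow> complex. continuous_on UNIV f \<and> f x0 \<in> {0}}"
    by (simp add: vanishing_at_def)
  have "field (ring_of_type_algebra :: complex ring)"
    by (rule field_from_type_algebra)
  from field.zeromaximalideal[OF this] have "maximalideal {0 :: complex} ring_of_type_algebra"
    by (simp add: ring_of_type_algebra_def)
  moreover from this have "ideal (vanishing_at x0 :: ('x \<Rightarrow> complex) set) cont_ring"
    unfolding eq by (intro ideal_evaluation) (simp add: maximalideal_type_algebra_iff)
  moreover have "inter_consts (vanishing_at x0 :: ('x \<Rightarrow> complex) set) = {0}"
    unfolding eq by (rule inter_consts_evaluation)
  ultimately show ?thesis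
    by (simp add: maximalideal_iff_inter_consts[of _ x0])
qed

section \<open>Scalar functions in an ideal\<close>

lemma scaleC_one_mult: "scaleC c 1 * x = scaleC c (x :: 'a::complex_comm_banach_algebra_1)"
  by (simp add: scaleC_mult_left)

lemma continuous_on_scaleC_one:
  assumes "continuous_on S g"
  shows "continuous_on S (\<lambda>x. scaleC (g x) (1 :: 'a::complex_comm_banach_algebra_1))"
proof -
  have "bounded_linear (\<lambda>c. scaleC c (1 :: 'a))"
  proof (rule bounded_linear_intro)
    show "scaleC (r *\<^sub>R c) (1 :: 'a) = r *\<^sub>R scaleC c 1" for r c
      by (simp add: scaleR_conv_of_real[of r c] flip: scaleC_scaleC scaleC_of_real)
    show "norm (scaleC c (1 :: 'a)) \<le> norm c * 1" for c
      by (simp add: norm_scaleC)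
  qed (rule scaleC_add_left)
  from bounded_linear.continuous_on[OF this assms] show ?thesis .
qed

context
  fixes M :: "('x::t2_space \<Rightarrow> 'a::complex_comm_banach_algebra_1) set"
  assumes comp: "compact (UNIV :: 'x set)" and M: "ideal M cont_ring"
begin

lemma ideal_inter_scalars: "ideal (inter_scalars M) cont_ring"
proof -
  have zero: "scaleC 0 (1 :: 'a) = 0"
    using scaleC_of_real[of 0 "1 :: 'a"] by simp
  have mult: "(\<lambda>x. scaleC (g x * f x) 1) \<in> M"
    if "(\<lambda>x. scaleC (f x) 1) \<in> M" "continuous_on UNIV g" for f g
    using cont_ideal_mult[OF M that(1) continuous_on_scaleC_one[OF that(2)]]
    by (simp add: scaleC_one_mult scaleC_scaleC)
  show ?thesis
    unfolding ideal_cont_ring_iff inter_scalars_def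
    using cont_ideal_zero[OF M] cont_ideal_add[OF M]
    by (simp add: zero mult scaleC_add_left continuous_on_add continuous_on_mult)
qed

text \<open>Urysohn functions and square roots of norms are real-valued; this moves them between
  \<open>M\<close> and its scalar part.\<close>

lemma of_real_in_inter_scalars:
  "(\<lambda>x. complex_of_real (\<phi> x)) \<in> inter_scalars M \<longleftrightarrow>
     continuous_on UNIV \<phi> \<and> (\<lambda>x. of_real (\<phi> x)) \<in> M"
proof -
  have "continuous_on UNIV \<phi>" if "continuous_on UNIV (\<lambda>x. complex_of_real (\<phi> x))"
    using continuous_on_Re[OF that] by simp
  then show ?thesis
    by (auto simp: inter_scalars_def scaleC_of_real of_real_def[where 'a = 'a]
        intro: continuous_on_of_real)
qed

text \<open>Both membership claims are proved by contradiction: a function outside \<open>M\<close>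
  has an inverse \<open>k\<close> modulo \<open>M\<close>.\<close>

lemma maximal_contains_vanishing_at:
  assumes max: "maximalideal M cont_ring"
  obtains x0 where "vanishing_at x0 \<subseteq> M"
proof -
  have one: "(\<lambda>x. 1) \<notin> M"
    using max by (simp add: maximalideal_cont_ring_iff)
  then have "(\<lambda>x. 1) \<notin> inter_scalars M"
    using of_real_in_inter_scalars[of "\<lambda>x. 1"] by simp
  then obtain x0 where x0: "inter_scalars M \<subseteq> vanishing_at x0"
    using scalar_ideal_common_zero[OF comp ideal_inter_scalars] by blast
  have loc: "h \<in> M" if h: "continuous_on UNIV h" "open U" "x0 \<in> U" "\<And>x. x \<in> U \<Longrightarrow> h x = 0" for h U
  proof (rule ccontr)
    assume "h \<notin> M"
    then obtain k where k: "continuous_on UNIV k" "(\<lambda>x. 1 - k x * h x) \<in> M"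
      using maximalideal_cont_ring_complement[OF max h(1)] by metis
    obtain \<phi> :: "'x \<Rightarrow> real" where \<phi>: "continuous_on UNIV \<phi>" "\<phi> x0 = 1"
      "\<And>x. x \<in> - U \<Longrightarrow> \<phi> x = 0"
      using compact_separation[OF comp, of "- U" x0] h by auto
    \<comment> \<open>On \<open>U\<close> the factor in parentheses is 1, and off \<open>U\<close>
      the function \<open>\<phi>\<close> is 0. So \<open>\<phi>\<close> lies in \<open>M\<close>,
      although it is nonzero at \<open>x0\<close>.\<close>
    have "of_real (\<phi> x) * (1 - k x * h x) = of_real (\<phi> x)" for x
      using h(4)[of x] \<phi>(3)[of x] by (cases "x \<in> U") auto
    with cont_ideal_mult[OF M k(2), of "\<lambda>x. of_real (\<phi> x)"] \<phi>(1)
    have "(\<lambda>x. of_real (\<phi> x)) \<in> M"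
      by (simp add: continuous_on_of_real)
    then have "(\<lambda>x. complex_of_real (\<phi> x)) \<in> inter_scalars M"
      using \<phi>(1) by (simp add: of_real_in_inter_scalars)
    with x0 \<phi>(2) show False
      by (auto simp: vanishing_at_def)
  qed
  have "f \<in> M" if f: "f \<in> vanishing_at x0" for f
  proof (rule ccontr)
    assume "f \<notin> M"
    then obtain k where k: "continuous_on UNIV k" "(\<lambda>x. 1 - k x * f x) \<in> M"
      using maximalideal_cont_ring_complement[OF max] f by (auto simp: vanishing_at_def)
    define w where "w x = k x * f x" for x
    have w: "continuous_on UNIV w" "w x0 = 0"
      using k(1) f by (simp_all add: w_def[abs_def] vanishing_at_def continuous_on_mult)
    obtain u where u: "continuous_on UNIV u" "\<And>x. norm (u x) \<le> 1/2"
      "\<And>x. norm (w x) < 1/2 \<Longrightarrow> u x = w x"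
      using continuous_truncation[OF w(1), of "1/2"] by auto
    \<comment> \<open>This difference vanishes near \<open>x0\<close>. Adding it to the member
      \<open>1 - w\<close> of \<open>M\<close> gives \<open>1 - u\<close>, which is invertible
      because \<open>u\<close> has norm at most 1/2.\<close>
    have "(\<lambda>x. w x - u x) \<in> M"
      by (rule loc[OF continuous_on_diff[OF w(1) u(1)] open_norm_less[OF w(1), of "1/2"]])
        (auto simp: w(2) u(3))
    from cont_ideal_add[OF M k(2) this] have "(\<lambda>x. 1 - u x) \<in> M"
      by (simp add: w_def)
    moreover obtain v where "continuous_on UNIV v" "\<And>x. v x * (1 - u x) = 1"
      using geometric_inverse[OF u(1,2)] by blast
    ultimately have "(\<lambda>x. 1) \<in> M"
      using cont_ideal_mult[OF M, of "\<lambda>x. 1 - u x" v] by simp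
    with one show False ..
  qed
  then show thesis
    by (intro that) auto
qed

text \<open>By maximality the scalar part of \<open>M\<close> is all of the complex
  \<open>vanishing_at x0\<close>. Hence it contains the square root of the norm of \<open>f\<close>,
  which divides \<open>f\<close>.\<close>

lemma inter_scalars_contains_vanishing_at:
  assumes max: "maximalideal (inter_scalars M) cont_ring"
  obtains x0 where "vanishing_at x0 \<subseteq> M"
proof -
  have "(\<lambda>x. 1) \<notin> inter_scalars M"
    using max by (simp add: maximalideal_cont_ring_iff)
  then obtain x0 where "inter_scalars M \<subseteq> vanishing_at x0"
    using scalar_ideal_common_zero[OF comp ideal_inter_scalars] by blast
  moreover have "(\<lambda>x. 1) \<notin> (vanishing_at x0 :: ('x \<Rightarrow> complex) set)"
    by (simp add: vanishing_at_def)
  moreover have "ideal (vanishing_at x0 :: ('x \<Rightarrow> complex) set) cont_ring"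
    using maximalideal_vanishing_at[of x0] by (simp add: maximalideal_cont_ring_iff)
  ultimately have x0: "vanishing_at x0 = inter_scalars M"
    using max by (simp add: maximalideal_cont_ring_iff)
  have "f \<in> M" if "f \<in> vanishing_at x0" for f
  proof -
    have f: "continuous_on UNIV f" "f x0 = 0"
      using that by (auto simp: vanishing_at_def)
    define q where "q x = sqrt (norm (f x))" for x
    \<comment> \<open>Since \<open>inverse 0 = 0\<close>, \<open>h\<close> is 0 at the zeros of
      \<open>f\<close>. Continuity there follows from \<open>norm (h x) = q x\<close>.\<close>
    define h where "h x = inverse (q x) *\<^sub>R f x" for x
    have q: "continuous_on UNIV q"
      unfolding q_def by (intro continuous_intros f)
    have qh: "of_real (q x) * h x = f x" for x
      by (cases "f x = 0") (auto simp: h_def q_def simp flip: scaleR_conv_of_real)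
    have nh: "norm (h x) = q x" for x
      by (cases "f x = 0") (auto simp: h_def q_def field_simps)
    have "isCont h y" for y
    proof (cases "f y = 0")
      case True
      have "(q \<longlongrightarrow> q y) (at y)"
        using q by (simp add: continuous_on_eq_continuous_at isCont_def)
      moreover have "q y = 0"
        by (simp add: q_def True)
      ultimately have "((\<lambda>x. norm (h x)) \<longlongrightarrow> 0) (at y)"
        by (simp add: nh)
      then have "(h \<longlongrightarrow> 0) (at y)"
        by (rule tendsto_norm_zero_cancel)
      with True show ?thesis
        by (simp add: isCont_def h_def)
    next
      case False
      then have "q y \<noteq> 0"
        by (simp add: q_def)
      with q f show ?thesis
        unfolding h_def[abs_def]
        by (intro continuous_intros) (auto simp: continuous_on_eq_continuous_at)
    qed
    then have h: "continuous_on UNIV h"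
      by (simp add: continuous_on_eq_continuous_at)
    have "(\<lambda>x. complex_of_real (q x)) \<in> inter_scalars M"
      unfolding x0[symmetric] using q f by (auto simp: vanishing_at_def q_def intro: continuous_on_of_real)
    then have "(\<lambda>x. of_real (q x)) \<in> M"
      by (simp add: of_real_in_inter_scalars)
    from cont_ideal_mult[OF M this h] show ?thesis
      by (simp add: qh mult.commute[of "h _"])
  qed
  then show thesis
    by (intro that) auto
qed

end

text \<open>Functions vanishing near \<open>x0\<close> lie in \<open>M\<close> by a colon ideal
  argument, and they approximate every function vanishing at \<open>x0\<close> uniformly.\<close>

lemma closed_contains_vanishing_at:
  fixes M :: "('x::t2_space \<Rightarrow> 'a::complex_comm_banach_algebra_1) set"
  assumes comp: "compact (UNIV :: 'x set)" and M: "ideal M cont_ring"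
    and clo: "uniformly_closed M" and fib: "\<And>x. x \<noteq> x0 \<Longrightarrow> values_at M x = UNIV"
  shows "vanishing_at x0 \<subseteq> M"
proof
  have loc: "h \<in> M" if h: "continuous_on UNIV h" "open U" "x0 \<in> U" "\<And>x. x \<in> U \<Longrightarrow> h x = 0" for h U
  proof (rule ccontr)
    assume "h \<notin> M"
    \<comment> \<open>The colon ideal of \<open>M\<close> and \<open>h\<close>: it contains
      \<open>M\<close>, and it contains 1 exactly when \<open>h \<in> M\<close>.\<close>
    define K where "K = {k. continuous_on UNIV k \<and> (\<lambda>x. k x * h x) \<in> M}"
    have K: "ideal K cont_ring"
      unfolding ideal_cont_ring_iff K_def
      using cont_ideal_zero[OF M] cont_ideal_add[OF M] cont_ideal_mult[OF M]
      by (auto simp: distrib_right mult.assoc intro!: continuous_on_add continuous_on_mult)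
    have MK: "M \<subseteq> K"
      unfolding K_def using cont_ideal_continuous[OF M] cont_ideal_mult[OF M _ h(1)]
      by (auto simp: mult.commute[of _ "h _"])
    have "(\<lambda>x. 1) \<notin> K"
      using \<open>h \<notin> M\<close> by (simp add: K_def)
    then obtain J where J: "maximalideal J cont_ring" "K \<subseteq> J"
      using cring.exists_maximalideal[OF cring_cont_ring K] by (auto simp: cont_ring_def)
    then have id: "ideal J cont_ring" and one: "(\<lambda>x. 1) \<notin> J"
      by (auto simp: maximalideal_cont_ring_iff)
    obtain y where y: "vanishing_at y \<subseteq> J"
      using maximal_contains_vanishing_at[OF comp id J(1)] by blast
    \<comment> \<open>Membership in \<open>J\<close> depends only on the value at \<open>y\<close>,
      so a value 1 there would put the constant 1 into \<open>J\<close>.\<close>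
    have "f y \<noteq> 1" if "f \<in> J" for f
      using one that cont_ideal_mem_iff[OF id y, of f] cont_ideal_mem_iff[OF id y, of "\<lambda>x. 1"]
      by auto
    then have no: "f y \<noteq> 1" if "f \<in> K" for f
      using that J(2) by blast
    \<comment> \<open>At \<open>y = x0\<close> a Urysohn function supported in \<open>U\<close>
      annihilates \<open>h\<close>, so it is a member of \<open>K\<close> with value 1. At any other
      \<open>y\<close> the full fibre of \<open>M\<close> supplies such a member.\<close>
    show False
    proof (cases "y = x0")
      case True
      obtain \<phi> :: "'x \<Rightarrow> real" where \<phi>: "continuous_on UNIV \<phi>" "\<phi> x0 = 1"
        "\<And>x. x \<in> - U \<Longrightarrow> \<phi> x = 0"
        using compact_separation[OF comp, of "- U" x0] h by auto
      have "of_real (\<phi> x) * h x = 0" for x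
        using h(4)[of x] \<phi>(3)[of x] by (cases "x \<in> U") auto
      then have "(\<lambda>x. of_real (\<phi> x)) \<in> K"
        using \<phi>(1) cont_ideal_zero[OF M] by (simp add: K_def continuous_on_of_real)
      from no[OF this] True \<phi>(2) show False
        by simp
    next
      case False
      then have "1 \<in> values_at M y"
        using fib by simp
      then obtain m where "m \<in> M" "m y = 1"
        by (auto simp: values_at_def)
      with no MK show False
        by blast
    qed
  qed
  fix f :: "'x \<Rightarrow> 'a" assume "f \<in> vanishing_at x0"
  then have f: "continuous_on UNIV f" "f x0 = 0"
    by (auto simp: vanishing_at_def)
  \<comment> \<open>Compactness makes continuous functions bounded, so they are points of the space
    in which closedness is stated.\<close>
  have bc: "g \<in> bcontfun" if "continuous_on UNIV g" for g :: "'x \<Rightarrow> 'a"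
    using that compact_imp_bounded[OF compact_continuous_image[OF that comp]] by (simp add: bcontfun_def)
  obtain F where F: "f = apply_bcontfun F"
    using bcontfunE[OF bc[OF f(1)]] .
  have "\<exists>G\<in>{G. apply_bcontfun G \<in> M}. dist G F < e" if "e > 0" for e
  proof -
    obtain u where u: "continuous_on UNIV u" "\<And>x. norm (u x) \<le> e/2"
      "\<And>x. norm (f x) < e/2 \<Longrightarrow> u x = f x"
      using continuous_truncation[OF f(1), of "e/2"] \<open>e > 0\<close> by auto
    have fu: "continuous_on UNIV (\<lambda>x. f x - u x)"
      using f(1) u(1) by (intro continuous_intros)
    have "(\<lambda>x. f x - u x) \<in> M"
      by (rule loc[OF fu open_norm_less[OF f(1), of "e/2"]]) (use \<open>e > 0\<close> f(2) u(3) in auto)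
    moreover obtain G where G: "(\<lambda>x. f x - u x) = apply_bcontfun G"
      using bcontfunE[OF bc[OF fu]] .
    moreover have "dist G F \<le> e/2"
    proof (rule dist_bound)
      show "dist (apply_bcontfun G x) (apply_bcontfun F x) \<le> e/2" for x
        using u(2)[of x] by (simp add: dist_norm flip: F G fun_cong[OF G])
    qed
    ultimately show ?thesis
      using \<open>e > 0\<close> by (intro bexI[of _ G]) auto
  qed
  then have "F \<in> closure {G. apply_bcontfun G \<in> M}"
    by (simp add: closure_approachable)
  with clo show "f \<in> M"
    by (simp add: uniformly_closed_def closure_closed F)
qed

section \<open>Maximal ideals\<close>

context
  fixes M :: "('x::t2_space \<Rightarrow> 'a::complex_comm_banach_algebra_1) set" and x0 :: 'x
  assumes comp: "compact (UNIV :: 'x set)" and max: "maximalideal M cont_ring"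
    and van: "vanishing_at x0 \<subseteq> M"
begin

lemma maximal_ideal: "ideal M cont_ring"
  using max by (simp add: maximalideal_cont_ring_iff)

lemma maximal_inter_consts: "maximalideal (inter_consts M) ring_of_type_algebra"
  using maximalideal_iff_inter_consts[OF maximal_ideal van] max by simp

text \<open>A nonzero multiple of the unit is invertible and so avoids the proper ideal
  \<open>inter_consts M\<close>. Hence the scalar functions in \<open>M\<close> are those vanishing
  at \<open>x0\<close>.\<close>

lemma maximal_inter_scalars: "maximalideal (inter_scalars M) cont_ring"
proof -
  have N: "ideal (inter_consts M) ring_of_type_algebra" "1 \<notin> inter_consts M"
    using maximal_inter_consts by (auto simp: maximalideal_type_algebra_iff)
  have "scaleC c 1 \<in> inter_consts M \<longleftrightarrow> c = 0" for c
  proof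
    assume "scaleC c 1 \<in> inter_consts M"
    then have "scaleC (inverse c) 1 * scaleC c 1 \<in> inter_consts M"
      using N(1) by (simp add: ideal_type_algebra_iff)
    then have "scaleC (inverse c * c) 1 \<in> inter_consts M"
      by (simp add: scaleC_one_mult scaleC_scaleC)
    then show "c = 0"
      using N(2) scaleC_of_real[of 1 "1 :: 'a"] by (cases "c = 0") auto
  next
    assume "c = 0"
    then show "scaleC c 1 \<in> inter_consts M"
      using N(1) scaleC_of_real[of 0 "1 :: 'a"] by (simp add: ideal_type_algebra_iff)
  qed
  then have "inter_scalars M = vanishing_at x0"
    using cont_ideal_mem_iff[OF maximal_ideal van]
    by (auto simp: inter_scalars_def vanishing_at_def continuous_on_scaleC_one)
  then show ?thesis
    by (simp add: maximalideal_vanishing_at)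
qed

text \<open>For \<open>x\<close> other than \<open>x0\<close>, multiples of a Urysohn function
  vanishing at \<open>x0\<close> take every value at \<open>x\<close>.\<close>

lemma maximal_values_at: "values_at M x \<noteq> UNIV \<longleftrightarrow> x = x0"
proof (cases "x = x0")
  case True
  then show ?thesis
    using maximal_inter_consts values_at_eq_inter_consts[OF maximal_ideal van]
    by (auto simp: maximalideal_type_algebra_iff)
next
  case False
  obtain \<phi> :: "'x \<Rightarrow> real" where \<phi>: "continuous_on UNIV \<phi>" "\<phi> x = 1" "\<phi> x0 = 0"
    using compact_separation[OF comp, of "{x0}" x] False by auto
  have "a \<in> values_at M x" for a
  proof -
    have "(\<lambda>y. \<phi> y *\<^sub>R a) \<in> M"
      using van \<phi> by (auto simp: vanishing_at_def subset_iff intro!: continuous_intros)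
    then show ?thesis
      using \<phi>(2) by (auto simp: values_at_def intro!: exI[of _ "\<lambda>y. \<phi> y *\<^sub>R a"])
  qed
  with False show ?thesis
    by auto
qed

text \<open>Evaluation at \<open>x0\<close> is continuous, and \<open>M\<close> is the preimage
  under it of a closed maximal ideal of \<open>A\<close>.\<close>

lemma maximal_uniformly_closed: "uniformly_closed M"
proof -
  have "continuous_on UNIV (\<lambda>F :: 'x \<Rightarrow>\<^sub>C 'a. apply_bcontfun F x0)"
    unfolding continuous_on_iff using dist_fun_lt_imp_dist_val_lt by blast
  moreover have "closed (inter_consts M)"
    by (rule closed_maximalideal[OF maximal_inter_consts])
  ultimately have "closed ((\<lambda>F :: 'x \<Rightarrow>\<^sub>C 'a. apply_bcontfun F x0) -` inter_consts M)"
    by (rule closed_vimage[rotated])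
  moreover have "(\<lambda>F :: 'x \<Rightarrow>\<^sub>C 'a. apply_bcontfun F x0) -` inter_consts M = {F. apply_bcontfun F \<in> M}"
    using cont_ideal_mem_iff[OF maximal_ideal van] by auto
  ultimately show ?thesis
    by (simp add: uniformly_closed_def)
qed

end

theorem theorem7:
  fixes M :: "('x::t2_space \<Rightarrow> 'a::complex_comm_banach_algebra_1) set"
  assumes "compact (UNIV :: 'x set)"
    and "ideal M cont_ring"
  shows "(maximalideal M cont_ring \<longleftrightarrow>
            maximalideal (inter_consts M) ring_of_type_algebra \<and>
            maximalideal (inter_scalars M) cont_ring)
       \<and> (maximalideal M cont_ring \<longleftrightarrow>
            uniformly_closed M \<and>
            (\<exists>x0. values_at M x0 \<noteq> UNIV \<and> (\<forall>x. values_at M x \<noteq> UNIV \<longrightarrow> x = x0) \<and>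
                  maximalideal (values_at M x0) ring_of_type_algebra))
       \<and> (maximalideal M cont_ring \<longleftrightarrow>
            (\<exists>x0 N. maximalideal N ring_of_type_algebra \<and>
                    M = {f. continuous_on UNIV f \<and> f x0 \<in> N}))"
    (is "(?i \<longleftrightarrow> ?ii) \<and> (?i \<longleftrightarrow> ?iii) \<and> (?i \<longleftrightarrow> ?iv)")
proof -
  note M = assms(2)
  have i: "?ii \<and> ?iii \<and> ?iv" if max: ?i
  proof -
    obtain x0 where van: "vanishing_at x0 \<subseteq> M"
      using maximal_contains_vanishing_at[OF assms max] .
    note * = assms(1) max van
    have ii: "?ii"
      by (rule conjI[OF maximal_inter_consts[OF *] maximal_inter_scalars[OF *]])
    have "maximalideal (values_at M x0) ring_of_type_algebra"
      unfolding values_at_eq_inter_consts[OF M van] by (rule maximal_inter_consts[OF *])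
    then have iii: "?iii"
      using maximal_uniformly_closed[OF *] maximal_values_at[OF *]
      by (intro conjI exI[of _ x0]) auto
    have iv: "?iv"
      by (rule exI[of _ x0], rule exI[of _ "inter_consts M"],
          rule conjI[OF maximal_inter_consts[OF *] eq_evaluation[OF M van]])
    show ?thesis
      by (rule conjI[OF ii conjI[OF iii iv]])
  qed
  have ii: "?i" if "?ii"
  proof -
    \<comment> \<open>The scalar half of (ii) provides the point; the half about constants then
      gives maximality.\<close>
    obtain x0 where "vanishing_at x0 \<subseteq> M"
      using inter_scalars_contains_vanishing_at[OF assms conjunct2[OF \<open>?ii\<close>]] .
    from maximalideal_iff_inter_consts[OF M this] conjunct1[OF \<open>?ii\<close>] show ?thesis
      by (rule iffD2)
  qed
  have iii: "?i" if "?iii"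
  proof -
    obtain x0 where x0: "\<forall>x. values_at M x \<noteq> UNIV \<longrightarrow> x = x0"
      "maximalideal (values_at M x0) ring_of_type_algebra"
      using conjunct2[OF \<open>?iii\<close>] by blast
    \<comment> \<open>Uniqueness of \<open>x0\<close> says that all other fibres are full.\<close>
    have van: "vanishing_at x0 \<subseteq> M"
      using x0(1) by (intro closed_contains_vanishing_at[OF assms conjunct1[OF \<open>?iii\<close>]]) auto
    from maximalideal_iff_inter_consts[OF M van] x0(2)[unfolded values_at_eq_inter_consts[OF M van]]
    show ?thesis
      by (rule iffD2)
  qed
  have iv: "?i" if "?iv"
  proof -
    obtain x0 N where N: "maximalideal N ring_of_type_algebra"
      and eq: "M = {f. continuous_on UNIV f \<and> f x0 \<in> N}"
      using \<open>?iv\<close> by blast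
    have van: "vanishing_at x0 \<subseteq> M"
      using N by (auto simp: eq vanishing_at_def maximalideal_type_algebra_iff ideal_type_algebra_iff)
    have "inter_consts M = N"
      unfolding eq by (rule inter_consts_evaluation)
    with N have "maximalideal (inter_consts M) ring_of_type_algebra"
      by simp
    with maximalideal_iff_inter_consts[OF M van] show ?thesis
      by (rule iffD2)
  qed
  have equivs: "(P \<longleftrightarrow> A) \<and> (P \<longleftrightarrow> B) \<and> (P \<longleftrightarrow> C)"
    if "P \<Longrightarrow> A \<and> B \<and> C" "A \<Longrightarrow> P" "B \<Longrightarrow> P" "C \<Longrightarrow> P" for P A B C
    using that by blast
  show ?thesis
    by (rule equivs[OF i ii iii iv])
qed

end
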